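(* Let $x_d\in(0,1)$, let $a\in L^\infty(0,1)$ be real-valued with $a|_{(0,x_d)}<0$ and $a|_{(x_d,1)}>0$, and let $a(0)<0$ and $a(1)>0$ be given real constants. Let $\varepsilon>0$. Then the function $\psi$ obtained from Steps 1--3 of the two-region domain decomposition algorithm (described in the context) belongs to $W^{2,\infty}(0,1)$ and is the unique solution in $W^{2,\infty}(0,1)$ of the boundary value problem $$\varepsilon^2\psi''(x)+a(x)\psi(x)=0,\quad x\in(0,1),$$ $$\varepsilon\psi'(0)-\sqrt{|a(0)|}\,\psi(0)=0,\qquad \varepsilon\psi'(1)-i\sqrt{a(1)}\,\psi(1)=-2i\sqrt{a(1)}.$$
   Context: Convention: $a(0)$ and $a(1)$ are not point values of the $L^\infty$-function $a$; they are given real constants (the constant values of the coefficient in the left lead $x\le 0$ and the right lead $x\ge 1$, respectively). Differential equations are understood to hold almost everywhere for $W^{2,\infty}$ functions, where $W^{2,\infty}\subset C^1$ up to the boundary. Two-region domain decomposition algorithm: Step 1. $\chi\in W^{2,\infty}(0,x_d)$ is the unique solution of the boundary value problem $\varepsilon^2\chi''+a\chi=0$ on $(0,x_d)$, $\varepsilon\chi'(0)-\sqrt{|a(0)|}\,\chi(0)=0$, $\varepsilon\chi'(x_d)=1$. Step 2. $\varphi\in W^{2,\infty}(x_d,1)$ is the unique solution of the initial value problem $\varepsilon^2\varphi''+a\varphi=0$ on $(x_d,1)$, $\varphi(x_d)=\chi(x_d)$, $\varepsilon\varphi'(x_d)=\varepsilon\chi'(x_d)=1$. Step 3. Set $\psi:=\alpha\chi$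 on $(0,x_d)$ and $\psi:=\alpha\varphi$ on $(x_d,1)$, where $$\alpha:=\frac{-2i\sqrt{a(1)}}{\varepsilon\varphi'(1)-i\sqrt{a(1)}\,\varphi(1)}\in\mathbb{C}.$$ (The functions $\chi,\varphi$ are real-valued and $\alpha$ is well-defined.) *)

theory Defs
  imports "HOL-Analysis.Analysis"
begin

definition L_inf :: "real set \<Rightarrow> (real \<Rightarrow> 'a::euclidean_space) set" where
  "L_inf S = {u. u \<in> borel_measurable (lebesgue_on S) \<and>
                 (\<exists>C. AE x in lebesgue_on S. norm (u x) \<le> C)}"

definition test_functions :: "real set \<Rightarrow> (real \<Rightarrow> real) set" where
  "test_functions S = {\<theta>. (\<forall>n x. (deriv ^^ n) \<theta> differentiable (at x)) \<and>
                           (\<exists>K. compact K \<and> K \<subseteq> S \<and> (\<forall>x. x \<notin> K \<longrightarrow> \<theta> x = 0))}"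

definition loc_integrable :: "real set \<Rightarrow> (real \<Rightarrow> 'a::euclidean_space) \<Rightarrow> bool" where
  "loc_integrable S u \<longleftrightarrow> (\<forall>K. compact K \<and> K \<subseteq> S \<longrightarrow> u absolutely_integrable_on K)"

definition has_weak_deriv ::
    "real set \<Rightarrow> (real \<Rightarrow> 'a::euclidean_space) \<Rightarrow> (real \<Rightarrow> 'a) \<Rightarrow> bool" where
  "has_weak_deriv S u v \<longleftrightarrow> loc_integrable S u \<and> loc_integrable S v \<and>
     (\<forall>\<theta>\<in>test_functions S.
        (LINT x:S|lebesgue. deriv \<theta> x *\<^sub>R u x) = - (LINT x:S|lebesgue. \<theta> x *\<^sub>R v x))"

primrec W_inf :: "nat \<Rightarrow> real set \<Rightarrow> (real \<Rightarrow> 'a::euclidean_space) set" where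
  "W_inf 0 S = L_inf S"
| "W_inf (Suc k) S = {u \<in> L_inf S. \<exists>v \<in> W_inf k S. has_weak_deriv S u v}"

definition C1_closed :: "real \<Rightarrow> real \<Rightarrow> (real \<Rightarrow> 'a::euclidean_space) set" where
  "C1_closed a b = {u. \<exists>u'. continuous_on {a..b} u' \<and>
      (\<forall>x\<in>{a..b}. (u has_vector_derivative u' x) (at x within {a..b}))}"

(* An element of W^{2,inf}(a,b) is a class of a.e. equal functions. By the embedding into
   C^1([a,b]) each class has exactly one representative that is C^1 up to the boundary; W2_inf
   consists of these representatives, so that boundary values are ordinary point values.
   Values outside [a,b] are irrelevant. *)
definition W2_inf :: "real \<Rightarrow> real \<Rightarrow> (real \<Rightarrow> 'a::euclidean_space) set" where
  "W2_inf a b = W_inf 2 {a<..<b} \<inter> C1_closed a b"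

(* The derivative on [a,b], one-sided at the end points. *)
abbreviation cderiv :: "real \<Rightarrow> real \<Rightarrow> (real \<Rightarrow> 'a::euclidean_space) \<Rightarrow> real \<Rightarrow> 'a" where
  "cderiv a b u x \<equiv> vector_derivative u (at x within {a..b})"

(* eps^2 u'' + q u = 0 almost everywhere on (a,b), u'' being the second weak derivative. *)
definition solves_ode ::
    "real \<Rightarrow> (real \<Rightarrow> real) \<Rightarrow> real \<Rightarrow> real \<Rightarrow> (real \<Rightarrow> 'a::euclidean_space) \<Rightarrow> bool" where
  "solves_ode \<epsilon> q a b u \<longleftrightarrow>
     (\<exists>u' u''. has_weak_deriv {a<..<b} u u' \<and> has_weak_deriv {a<..<b} u' u'' \<and>
        (AE x in lebesgue_on {a<..<b}. \<epsilon>\<^sup>2 *\<^sub>R u'' x + q x *\<^sub>R u x = 0))"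

(* Below, a0 and a1 are the constants a(0) and a(1), which are not point values of a. *)

definition step1_solution ::
    "real \<Rightarrow> (real \<Rightarrow> real) \<Rightarrow> real \<Rightarrow> real \<Rightarrow> (real \<Rightarrow> real) \<Rightarrow> bool" where
  "step1_solution \<epsilon> a a0 xd chi \<longleftrightarrow>
     chi \<in> W2_inf 0 xd \<and> solves_ode \<epsilon> a 0 xd chi \<and>
     \<epsilon> * cderiv 0 xd chi 0 - sqrt \<bar>a0\<bar> * chi 0 = 0 \<and>
     \<epsilon> * cderiv 0 xd chi xd = 1"

definition step2_solution ::
    "real \<Rightarrow> (real \<Rightarrow> real) \<Rightarrow> real \<Rightarrow> (real \<Rightarrow> real) \<Rightarrow> (real \<Rightarrow> real) \<Rightarrow> bool" where
  "step2_solution \<epsilon> a xd chi phi \<longleftrightarrow>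
     phi \<in> W2_inf xd 1 \<and> solves_ode \<epsilon> a xd 1 phi \<and>
     phi xd = chi xd \<and>
     \<epsilon> * cderiv xd 1 phi xd = \<epsilon> * cderiv 0 xd chi xd"

definition step3_alpha :: "real \<Rightarrow> real \<Rightarrow> real \<Rightarrow> (real \<Rightarrow> real) \<Rightarrow> complex" where
  "step3_alpha \<epsilon> a1 xd phi =
     (- 2 * \<i> * of_real (sqrt a1)) /
     (of_real (\<epsilon> * cderiv xd 1 phi 1) - \<i> * of_real (sqrt a1) * of_real (phi 1))"

definition step3_psi ::
    "real \<Rightarrow> real \<Rightarrow> real \<Rightarrow> (real \<Rightarrow> real) \<Rightarrow> (real \<Rightarrow> real) \<Rightarrow> real \<Rightarrow> complex" where
  "step3_psi \<epsilon> a1 xd chi phi x =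
     step3_alpha \<epsilon> a1 xd phi * of_real (if x \<le> xd then chi x else phi x)"

definition bvp_solution ::
    "real \<Rightarrow> (real \<Rightarrow> real) \<Rightarrow> real \<Rightarrow> real \<Rightarrow> (real \<Rightarrow> complex) \<Rightarrow> bool" where
  "bvp_solution \<epsilon> a a0 a1 u \<longleftrightarrow>
     u \<in> W2_inf 0 1 \<and> solves_ode \<epsilon> a 0 1 u \<and>
     of_real \<epsilon> * cderiv 0 1 u 0 - of_real (sqrt \<bar>a0\<bar>) * u 0 = 0 \<and>
     of_real \<epsilon> * cderiv 0 1 u 1 - \<i> * of_real (sqrt a1) * u 1 = - 2 * \<i> * of_real (sqrt a1)"

end

theory Submission
  imports Defs
begin

text \<open>Gluing the two partial solutions at the interface gives a real solution \<open>y\<close> of the differential equation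
on \<open>(0,1)\<close> satisfying the homogeneous left boundary condition and \<open>\<epsilon> y'(xd) = 1\<close>. The solution space of a
second order equation with prescribed homogeneous left condition is one-dimensional, so every complex
solution satisfying it is a multiple \<open>s y\<close>: here \<open>y 0 \<noteq> 0\<close>, as otherwise the Cauchy data at \<open>0\<close>, and
with them \<open>y\<close>, would vanish. For such a multiple the right boundary condition reads
\<open>s (\<epsilon> y'(1) - \<i> \<surd>a1 y(1)) = - 2 \<i> \<surd>a1\<close>. Because \<open>y\<close> is real, the bracket can vanish only if
\<open>y(1) = y'(1) = 0\<close>, which again would mean \<open>y = 0\<close>. Hence exactly one multiple solves the boundary
value problem, and its factor is the scaling constant of the algorithm.

The argument thus rests on uniqueness for initial value problems posed at either end point (\<open>caratheodory_solution_unique\<close>), a consequence of Gronwall's inequality for the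
integrated first order system. What remains is to pass between this integrated form and the weak
formulation. Indefinite integrals of essentially bounded functions have the integrand as weak derivative,
by integration by parts (\<open>primitive_has_weak_deriv\<close>). Conversely, a continuous function with an essentially
bounded weak derivative is the indefinite integral of it (\<open>continuous_weak_deriv_imp_primitive\<close>), by
the lemma of du Bois-Reymond, for which smooth bump functions are constructed.\<close>

section \<open>Smooth bump functions\<close>

text \<open>Smoothness of a test function is a statement about iterated \<^const>\<open>deriv\<close>, which is awkward for products.
The predicate below exhibits the derivatives one at a time, so that closure properties follow by
induction on the order; a function having it for every order is smooth.\<close>

primrec times_differentiable :: "nat \<Rightarrow> (real \<Rightarrow> real) \<Rightarrow> bool" where
  "times_differentiable 0 f \<longleftrightarrow> True"
| "times_differentiable (Suc k) f \<longleftrightarrow>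
     (\<exists>f'. (\<forall>x. (f has_real_derivative f' x) (at x)) \<and> times_differentiable k f')"

lemma times_differentiable_add:
  "times_differentiable k f \<Longrightarrow> times_differentiable k g \<Longrightarrow> times_differentiable k (\<lambda>x. f x + g x)"
proof (induction k arbitrary: f g)
  case (Suc k)
  then obtain f' g' where "\<forall>x. (f has_real_derivative f' x) (at x)" "times_differentiable k f'"
    "\<forall>x. (g has_real_derivative g' x) (at x)" "times_differentiable k g'" by auto
  with Suc.IH show ?case
    by (auto intro!: exI[of _ "\<lambda>x. f' x + g' x"] derivative_intros)
qed simp

lemma times_differentiable_cmult:
  "times_differentiable k f \<Longrightarrow> times_differentiable k (\<lambda>x. c * f x)"
proof (induction k arbitrary: f)
  case (Suc k)
  then obtain f' where "\<forall>x. (f has_real_derivative f' x) (at x)" "times_differentiable k f'" by auto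
  with Suc.IH show ?case
    by (auto intro!: exI[of _ "\<lambda>x. c * f' x"] DERIV_cmult)
qed simp

lemma times_differentiable_Suc_imp:
  "times_differentiable (Suc k) f \<Longrightarrow> times_differentiable k f"
proof (induction k arbitrary: f)
  case (Suc k)
  then show ?case by (metis times_differentiable.simps(2))
qed simp

lemma times_differentiable_mult:
  "times_differentiable k f \<Longrightarrow> times_differentiable k g \<Longrightarrow> times_differentiable k (\<lambda>x. f x * g x)"
proof (induction k arbitrary: f g)
  case (Suc k)
  then obtain f' g' where f: "\<forall>x. (f has_real_derivative f' x) (at x)" "times_differentiable k f'"
    and g: "\<forall>x. (g has_real_derivative g' x) (at x)" "times_differentiable k g'" by auto
  have "times_differentiable k (\<lambda>x. f x * g' x + f' x * g x)"
    by (intro times_differentiable_add Suc.IH f g Suc.prems[THEN times_differentiable_Suc_imp])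
  moreover have "((\<lambda>x. f x * g x) has_real_derivative f x * g' x + f' x * g x) (at x)" for x
    using f(1) g(1) by (auto intro!: derivative_eq_intros)
  ultimately show ?case 
    by (auto intro!: exI[of _ "\<lambda>x. f x * g' x + f' x * g x"])
qed simp

lemma times_differentiable_affine:
  "times_differentiable k f \<Longrightarrow> times_differentiable k (\<lambda>x. f (m * x + c))"
proof (induction k arbitrary: f)
  case (Suc k)
  then obtain f' where f: "\<forall>x. (f has_real_derivative f' x) (at x)" "times_differentiable k f'" by auto
  have "((\<lambda>x. f (m * x + c)) has_real_derivative m * f' (m * x + c)) (at x)" for x
    by (rule DERIV_cong[OF DERIV_chain'[OF _ f(1)[rule_format]]]) (auto intro!: derivative_eq_intros)
  with Suc.IH[OF f(2)] show ?case
    by (auto intro!: exI[of _ "\<lambda>x. m * f' (m * x + c)"] times_differentiable_cmult)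
qed simp

lemma times_differentiable_imp_higher_deriv_differentiable:
  assumes "\<And>k. times_differentiable k f"
  shows "(deriv ^^ n) f differentiable (at x)"
proof -
  have "times_differentiable (Suc n) f \<Longrightarrow> times_differentiable 1 ((deriv ^^ n) f)"
  proof (induction n arbitrary: f)
    case (Suc n)
    then obtain f' where f: "\<forall>x. (f has_real_derivative f' x) (at x)" "times_differentiable (Suc n) f'"
      by (metis times_differentiable.simps(2))
    then have "deriv f = f'" by (auto intro: DERIV_imp_deriv)
    with f Suc.IH show ?case by (simp add: funpow_Suc_right del: funpow.simps times_differentiable.simps)
  qed simp
  with assms have "times_differentiable 1 ((deriv ^^ n) f)" by blast
  then show ?thesis by (auto simp: real_differentiable_def)
qed

text \<open>The family \<open>exp (-1/x) / x\<^sup>n\<close>, extended by zero to \<open>x \<le> 0\<close>. Its span is closed under differentiation,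
which yields the smoothness of the usual flat function \<open>exp (-1/x)\<close> without computing higher derivatives.\<close>

definition exp_recip :: "nat \<Rightarrow> real \<Rightarrow> real" where
  "exp_recip n x = (if x > 0 then exp (- (1 / x)) / x ^ n else 0)"

text \<open>The substitution \<open>t = 1/x\<close> turns this into the fact that \<open>exp t\<close> outgrows every power of \<open>t\<close>.
Since \<open>exp_recip n h / h = exp_recip (n + 1) h\<close>, it also gives differentiability at \<open>0\<close>.\<close>

lemma exp_recip_tendsto_0: "(exp_recip n \<longlongrightarrow> 0) (at 0)"
proof -
  have "((\<lambda>x. (inverse x) ^ n / exp (inverse x)) \<longlongrightarrow> (0::real)) (at_right 0)"
    by (rule filterlim_compose[OF tendsto_power_div_exp_0 filterlim_inverse_at_top_right])
  then have "(exp_recip n \<longlongrightarrow> 0) (at_right 0)"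
    by (rule Lim_transform_eventually)
      (auto simp: eventually_at_right_less exp_recip_def exp_minus field_simps eventually_at
        intro!: exI[of _ 1])
  moreover have "(exp_recip n \<longlongrightarrow> 0) (at_left 0)"
    by (rule Lim_transform_eventually[OF tendsto_const])
      (auto simp: exp_recip_def eventually_at intro!: exI[of _ 1])
  ultimately show ?thesis by (simp add: filterlim_at_split)
qed

lemma exp_recip_has_derivative:
  "(exp_recip n has_real_derivative - real n * exp_recip (Suc n) x + exp_recip (n + 2) x) (at x)"
proof -
  consider "x > 0" | "x < 0" | "x = 0" by linarith
  then show ?thesis
  proof cases
    case 1
    have power_pred: "m = 0 \<or> x ^ m = x * x ^ (m - 1)" for m by (cases m) auto
    have "((\<lambda>x. exp (- (1 / x)) / x ^ n) has_real_derivative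
        - real n * exp_recip (Suc n) x + exp_recip (n + 2) x) (at x)"
      using 1 power_pred[of "n - 1"]
      by (cases n) (auto intro!: derivative_eq_intros simp: exp_recip_def field_simps power2_eq_square)
    then show ?thesis
      by (rule has_field_derivative_transform_within_open[where S = "{0<..}"])
        (use 1 in \<open>auto simp: exp_recip_def\<close>)
  next
    case 2
    have "((\<lambda>x. 0) has_real_derivative 0) (at x)" by simp
    then have "(exp_recip n has_real_derivative 0) (at x)"
      by (rule has_field_derivative_transform_within_open[where S = "{..<0}"])
        (use 2 in \<open>auto simp: exp_recip_def\<close>)
    with 2 show ?thesis by (simp add: exp_recip_def)
  next
    case 3
    have "((\<lambda>h. (exp_recip n (0 + h) - exp_recip n 0) / h) \<longlongrightarrow> 0) (at 0)"
      by (rule Lim_transform_eventually[OF exp_recip_tendsto_0[of "Suc n"]])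
        (auto simp: exp_recip_def eventually_at intro!: exI[of _ 1])
    with 3 show ?thesis by (simp add: exp_recip_def DERIV_def)
  qed
qed

lemma times_differentiable_exp_recip: "times_differentiable k (exp_recip n)"
proof (induction k arbitrary: n)
  case (Suc k)
  then show ?case
    using exp_recip_has_derivative[of n]
    by (auto intro!: exI[of _ "\<lambda>x. - real n * exp_recip (Suc n) x + exp_recip (n + 2) x"]
        times_differentiable_add times_differentiable_cmult simp del: add_2_eq_Suc')
qed simp

definition bump :: "real \<Rightarrow> real \<Rightarrow> real" where
  "bump \<delta> t = exp_recip 0 (\<delta> + t) * exp_recip 0 (\<delta> - t)"

lemma times_differentiable_bump: "times_differentiable k (\<lambda>t. bump \<delta> (t - c))"
proof -
  have "times_differentiable k (\<lambda>t. exp_recip 0 (1 * t + (\<delta> - c)) * exp_recip 0 ((-1) * t + (\<delta> + c)))"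
    by (intro times_differentiable_mult times_differentiable_affine times_differentiable_exp_recip)
  then show ?thesis by (simp add: bump_def algebra_simps)
qed

lemma bump_nonneg: "bump \<delta> t \<ge> 0"
  by (simp add: bump_def exp_recip_def)

lemma bump_pos: "\<bar>t\<bar> < \<delta> \<Longrightarrow> bump \<delta> t > 0"
  by (simp add: bump_def exp_recip_def)

lemma bump_eq_0: "\<delta> \<le> \<bar>t\<bar> \<Longrightarrow> bump \<delta> t = 0"
  by (auto simp: bump_def exp_recip_def)

lemma continuous_on_bump: "continuous_on S (\<lambda>t. bump \<delta> (t - c))"
proof -
  have "times_differentiable 1 (\<lambda>t. bump \<delta> (t - c))" by (rule times_differentiable_bump)
  then show ?thesis
    by (auto intro!: continuous_at_imp_continuous_on intro: DERIV_isCont)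
qed

definition bump_mass :: "real \<Rightarrow> real" where
  "bump_mass \<delta> = integral {-\<delta>..\<delta>} (bump \<delta>)"

lemma bump_has_integral:
  assumes "a \<le> x - \<delta>" "x + \<delta> \<le> b" 
  shows "((\<lambda>t. bump \<delta> (t - x)) has_integral bump_mass \<delta>) {a..b}"
proof -
  have "(bump \<delta> has_integral bump_mass \<delta>) {-\<delta>..\<delta>}"
    unfolding bump_mass_def
    using continuous_on_bump[of _ \<delta> 0] by (auto intro!: integrable_integral integrable_continuous_real)
  then have "((\<lambda>t. bump \<delta> (t - x)) has_integral bump_mass \<delta>) {x - \<delta>..x + \<delta>}"
    using has_integral_shift_Icc_real[where f = "\<lambda>t. bump \<delta> (t - x)" and a = "-\<delta>" and c = x and b = "\<delta>"]
    by (simp add: o_def add.commute)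
  then show ?thesis
    by (rule has_integral_on_superset) (use assms in \<open>auto intro!: bump_eq_0\<close>)
qed

lemma bump_mass_pos: "\<delta> > 0 \<Longrightarrow> bump_mass \<delta> > 0"
  unfolding bump_mass_def
  using continuous_on_bump[of _ \<delta> 0]
  by (intro integral_less_real[where f = "\<lambda>_. 0", simplified]) (auto intro: bump_pos)

text \<open>Testing with a narrow bump at \<open>x\<close> recovers the value at \<open>x\<close> up to the oscillation of the function there.\<close>

lemma bump_average_approx:
  fixes g :: "real \<Rightarrow> 'a::euclidean_space"
  assumes g: "continuous_on {a..b} g" and "a \<le> x - \<delta>" "x + \<delta> \<le> b"
    and e: "\<And>t. \<bar>t - x\<bar> < \<delta> \<Longrightarrow> norm (g t - g x) \<le> e"
  shows "norm (integral {a..b} (\<lambda>t. bump \<delta> (t - x) *\<^sub>R g t) - bump_mass \<delta> *\<^sub>R g x) \<le> bump_mass \<delta> * e"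
proof -
  note m = bump_has_integral[OF assms(2,3)]
  have "((\<lambda>t. bump \<delta> (t - x) *\<^sub>R g t) has_integral integral {a..b} (\<lambda>t. bump \<delta> (t - x) *\<^sub>R g t)) {a..b}"
    by (intro integrable_integral integrable_continuous_real continuous_intros continuous_on_bump g)
  moreover have "((\<lambda>t. bump \<delta> (t - x) *\<^sub>R g x) has_integral bump_mass \<delta> *\<^sub>R g x) {a..b}"
    by (rule has_integral_scaleR_left[OF m])
  ultimately have d: "((\<lambda>t. bump \<delta> (t - x) *\<^sub>R (g t - g x)) has_integral
      (integral {a..b} (\<lambda>t. bump \<delta> (t - x) *\<^sub>R g t) - bump_mass \<delta> *\<^sub>R g x)) {a..b}"
    unfolding scaleR_diff_right by (rule has_integral_diff)
  have le: "norm (bump \<delta> (t - x) *\<^sub>R (g t - g x)) \<le> bump \<delta> (t - x) * e" for t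
    using e[of t] bump_eq_0[of \<delta> "t - x"] bump_nonneg[of \<delta> "t - x"]
    by (cases "\<bar>t - x\<bar> < \<delta>") (auto intro: mult_left_mono)
  have me: "((\<lambda>t. bump \<delta> (t - x) * e) has_integral (bump_mass \<delta> * e)) {a..b}"
    by (rule has_integral_mult_left[OF m])
  show ?thesis
    using integral_norm_bound_integral[OF has_integral_integrable[OF d] has_integral_integrable[OF me]] le
    by (simp add: integral_unique[OF d] integral_unique[OF m] integral_unique[OF me])
qed

text \<open>The point of the hypothesis on \<open>h\<close> is that the lower limit \<open>c\<close> may be moved to the left of any given \<open>t\<close>;
for \<open>t < c\<close> the integral is over the empty interval and hence zero.\<close>

lemma integral_from_zero_region_has_derivative:
  fixes h :: "real \<Rightarrow> real"
  assumes h: "continuous_on UNIV h" and z: "\<And>t. t \<le> c \<Longrightarrow> h t = 0"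
  shows "((\<lambda>t. integral {c..t} h) has_real_derivative h t) (at t)"
proof -
  \<comment> \<open>A lower limit strictly below both \<open>c\<close> and \<open>t\<close>, so that \<open>t\<close> is interior to the interval of integration.\<close>
  define l where "l = min c t - 1"
  have eq: "integral {c..s} h = integral {l..s} h" for s
  proof (cases "c \<le> s")
    case True
    have "(h has_integral integral {c..s} h) {c..s}"
      by (intro integrable_integral integrable_continuous_real continuous_on_subset[OF h]) auto
    moreover have "(h has_integral 0) {l..c}" by (rule has_integral_is_0) (auto intro: z)
    ultimately have "(h has_integral 0 + integral {c..s} h) {l..s}"
      using True by (intro has_integral_combine[of l c s]) (auto simp: l_def)
    then show ?thesis by (simp add: integral_unique)
  next
    case False
    then have "integral {l..s} h = integral {l..s} (\<lambda>_. 0)" by (intro integral_cong z) auto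
    with False show ?thesis by simp
  qed
  have "((\<lambda>s. integral {l..s} h) has_real_derivative h t) (at t within {l..t+1})"
    by (rule integral_has_real_derivative) (auto simp: l_def intro: continuous_on_subset[OF h])
  moreover have "at t within {l..t+1} = at t"
    by (rule at_within_Icc_at) (auto simp: l_def)
  ultimately show ?thesis by (simp add: eq)
qed

text \<open>Both bumps have the same mass, so the primitive of their difference vanishes again to the right of both.\<close>

lemma test_function_bump_difference:
  assumes "\<delta> > 0" "a < x - \<delta>" "x + \<delta> < b" "a < y - \<delta>" "y + \<delta> < b"
  obtains \<theta> where "\<theta> \<in> test_functions {a<..<b}" 
    "deriv \<theta> = (\<lambda>t. bump \<delta> (t - x) - bump \<delta> (t - y))"
proof
  define h where "h = (\<lambda>t. bump \<delta> (t - x) - bump \<delta> (t - y))"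
  define c where "c = min x y - \<delta>"
  define d where "d = max x y + \<delta>"
  define \<theta> where "\<theta> = (\<lambda>t. integral {c..t} h)"
  have der: "(\<theta> has_real_derivative h t) (at t)" for t
    unfolding \<theta>_def
  proof (rule integral_from_zero_region_has_derivative)
    show "continuous_on UNIV h" unfolding h_def by (intro continuous_intros continuous_on_bump)
    show "h t = 0" if "t \<le> c" for t using that by (auto simp: h_def c_def bump_eq_0)
  qed
  then show "deriv \<theta> = (\<lambda>t. bump \<delta> (t - x) - bump \<delta> (t - y))"
    by (auto simp: h_def intro!: DERIV_imp_deriv)
  have "times_differentiable k h" for k
  proof -
    have "times_differentiable k (\<lambda>t. bump \<delta> (t - x) + (-1) * bump \<delta> (t - y))"
      by (intro times_differentiable_add times_differentiable_cmult times_differentiable_bump)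
    then show ?thesis by (simp add: h_def)
  qed
  then have "times_differentiable k \<theta>" for k using der by (cases k) auto
  moreover have "\<theta> t = 0" if "t \<notin> {c..d}" for t
  proof (cases "t < c")
    case False
    with that have "c \<le> x - \<delta>" "x + \<delta> \<le> t" "c \<le> y - \<delta>" "y + \<delta> \<le> t" by (auto simp: c_def d_def)
    then have "(h has_integral bump_mass \<delta> - bump_mass \<delta>) {c..t}"
      unfolding h_def by (intro has_integral_diff bump_has_integral)
    then show ?thesis by (simp add: \<theta>_def integral_unique)
  qed (simp add: \<theta>_def)
  moreover have "{c..d} \<subseteq> {a<..<b}" using assms by (auto simp: c_def d_def)
  ultimately show "\<theta> \<in> test_functions {a<..<b}"
    by (auto simp: test_functions_def times_differentiable_imp_higher_deriv_differentiable
        intro!: exI[of _ "{c..d}"])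
qed

text \<open>If two interior values differed, a test function whose derivative is a difference of two narrow bumps
of equal mass at the two points would give a nonzero integral. The end points follow by continuity.\<close>

lemma du_Bois_Reymond:
  fixes g :: "real \<Rightarrow> 'a::euclidean_space"
  assumes g: "continuous_on {a..b} g"
    and test: "\<And>\<theta>. \<theta> \<in> test_functions {a<..<b} \<Longrightarrow> ((\<lambda>t. deriv \<theta> t *\<^sub>R g t) has_integral 0) {a..b}"
    and "x \<in> {a..b}" "y \<in> {a..b}"
  shows "g x = g y"
proof -
  have interior: "g x = g y" if x: "x \<in> {a<..<b}" and y: "y \<in> {a<..<b}" for x y
  proof (rule ccontr)
    assume "g x \<noteq> g y"
    \<comment> \<open>Each average errs by at most \<open>e\<close>, so equal averages give \<open>norm (g x - g y) \<le> 2 * e\<close>.\<close>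
    define e where "e = norm (g x - g y) / 4"
    have e: "e > 0" using \<open>g x \<noteq> g y\<close> by (simp add: e_def)
    have "isCont g x" "isCont g y"
      using g x y by (auto intro!: continuous_on_interior)
    then have "\<exists>d>0. \<forall>t. \<bar>t - x\<bar> < d \<longrightarrow> norm (g t - g x) < e"
      "\<exists>d>0. \<forall>t. \<bar>t - y\<bar> < d \<longrightarrow> norm (g t - g y) < e"
      using e by (auto simp: continuous_at_eps_delta dist_norm)
    then obtain d1 d2 where d: "d1 > 0" "\<And>t. \<bar>t - x\<bar> < d1 \<Longrightarrow> norm (g t - g x) < e"
      "d2 > 0" "\<And>t. \<bar>t - y\<bar> < d2 \<Longrightarrow> norm (g t - g y) < e"
      by blast
    define d3 where "d3 = min (min (x - a) (b - x)) (min (y - a) (b - y)) / 2"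
    have "d3 > 0" using x y by (simp add: d3_def)
    moreover have "2 * d3 \<le> x - a" "2 * d3 \<le> b - x" "2 * d3 \<le> y - a" "2 * d3 \<le> b - y"
      by (simp_all add: d3_def)
    ultimately have d3: "d3 > 0" "a < x - d3" "x + d3 < b" "a < y - d3" "y + d3 < b"
      by linarith+
    define \<delta> where "\<delta> = min d1 (min d2 d3)"
    have \<delta>: "\<delta> > 0" "a < x - \<delta>" "x + \<delta> < b" "a < y - \<delta>" "y + \<delta> < b"
      using d3 d by (auto simp: \<delta>_def)
    obtain \<theta> where \<theta>: "\<theta> \<in> test_functions {a<..<b}"
      "deriv \<theta> = (\<lambda>t. bump \<delta> (t - x) - bump \<delta> (t - y))"
      using test_function_bump_difference[OF \<delta>] by blast
    have int: "(\<lambda>t. bump \<delta> (t - z) *\<^sub>R g t) integrable_on {a..b}" for z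
      by (intro integrable_continuous_real continuous_intros continuous_on_bump g)
    have "integral {a..b} (\<lambda>t. bump \<delta> (t - x) *\<^sub>R g t) = integral {a..b} (\<lambda>t. bump \<delta> (t - y) *\<^sub>R g t)"
      using integral_unique[OF test[OF \<theta>(1)]]
      by (simp add: \<theta>(2) scaleR_diff_left Henstock_Kurzweil_Integration.integral_diff int)
    moreover have "norm (integral {a..b} (\<lambda>t. bump \<delta> (t - x) *\<^sub>R g t) - bump_mass \<delta> *\<^sub>R g x) \<le> bump_mass \<delta> * e"
      by (rule bump_average_approx[OF g]) (use \<delta> d(2) in \<open>auto simp: \<delta>_def intro: less_imp_le\<close>)
    moreover have "norm (integral {a..b} (\<lambda>t. bump \<delta> (t - y) *\<^sub>R g t) - bump_mass \<delta> *\<^sub>R g y) \<le> bump_mass \<delta> * e"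
      by (rule bump_average_approx[OF g]) (use \<delta> d(4) in \<open>auto simp: \<delta>_def intro: less_imp_le\<close>)
    ultimately have "norm (bump_mass \<delta> *\<^sub>R g x - bump_mass \<delta> *\<^sub>R g y) \<le> bump_mass \<delta> * e + bump_mass \<delta> * e"
      by (smt (verit) norm_minus_commute norm_diff_triangle_le)
    then have "bump_mass \<delta> * (4 * e) \<le> bump_mass \<delta> * (2 * e)"
      using bump_mass_pos[OF \<delta>(1)]
      by (simp add: e_def flip: scaleR_diff_right)
    with bump_mass_pos[OF \<delta>(1)] e show False by simp
  qed
  show ?thesis
  proof (cases "a < b")
    case True
    have "g z = g ((a + b) / 2)" if "z \<in> {a..b}" for z
    proof (rule continuous_constant_on_closure[where S = "{a<..<b}"])
      show "continuous_on (closure {a<..<b}) g" using True g by simp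
      show "z \<in> closure {a<..<b}" using that True by simp
      show "g w = g ((a + b) / 2)" if "w \<in> {a<..<b}" for w
        by (rule interior[OF that]) (use True in auto)
    qed
    from this[OF assms(3)] this[OF assms(4)] show ?thesis by simp
  next
    case False
    with assms(3,4) have "x = y" by auto
    then show ?thesis by simp
  qed
qed

section \<open>Primitives of bounded functions as weak antiderivatives\<close>

lemma AE_lebesgue_on_iff:
  "S \<in> sets lebesgue \<Longrightarrow> (AE x in lebesgue_on S. P x) \<longleftrightarrow> (AE x in lebesgue. x \<in> S \<longrightarrow> P x)"
  by (subst AE_restrict_space_iff) auto

lemma L_inf_bounded_off_negligible:
  fixes u :: "real \<Rightarrow> 'a::euclidean_space"
  assumes "u \<in> L_inf S" "S \<in> sets lebesgue"
  obtains N C where "negligible N" "C \<ge> 0" "\<And>x. x \<in> S - N \<Longrightarrow> norm (u x) \<le> C"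
proof -
  obtain C where "AE x in lebesgue. x \<in> S \<longrightarrow> norm (u x) \<le> C"
    using assms by (auto simp: L_inf_def AE_lebesgue_on_iff)
  then obtain N where "N \<in> null_sets lebesgue" "{x \<in> space lebesgue. \<not> (x \<in> S \<longrightarrow> norm (u x) \<le> C)} \<subseteq> N"
    unfolding eventually_ae_filter by blast
  then show ?thesis
    by (intro that[of N "max C 0"]) (force simp: negligible_iff_null_sets)+
qed

lemma L_inf_absolutely_integrable:
  fixes u :: "real \<Rightarrow> 'a::euclidean_space"
  assumes "u \<in> L_inf {a<..<b}"
  shows "u absolutely_integrable_on {a<..<b}"
proof -
  interpret finite_measure "lebesgue_on {a<..<b}"
    by (rule finite_measure_lebesgue_on) auto
  have "integrable (lebesgue_on {a<..<b}) u"
    using assms by (auto simp: L_inf_def intro: integrable_const_bound)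
  then show ?thesis
    by (simp add: integrable_restrict_space set_integrable_def)
qed

lemma L_inf_continuous:
  fixes u :: "real \<Rightarrow> 'a::euclidean_space"
  assumes "continuous_on {a..b} u"
  shows "u \<in> L_inf {a<..<b}"
proof -
  obtain C where "\<And>x. x \<in> {a..b} \<Longrightarrow> norm (u x) \<le> C"
    using compact_continuous_image[OF assms] compact_imp_bounded by (force simp: bounded_iff)
  then have "AE x in lebesgue_on {a<..<b}. norm (u x) \<le> C"
    by (intro AE_I2) auto
  moreover have "u \<in> borel_measurable (lebesgue_on {a<..<b})"
    by (rule continuous_imp_measurable_on_sets_lebesgue[OF continuous_on_subset[OF assms]]) auto
  ultimately show ?thesis by (auto simp: L_inf_def)
qed

lemma L_inf_scaleR:
  fixes u :: "real \<Rightarrow> 'a::euclidean_space"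
  assumes "f \<in> L_inf S" "u \<in> L_inf S"
  shows "(\<lambda>x. f x *\<^sub>R u x) \<in> L_inf S"
proof -
  obtain C D where C: "AE x in lebesgue_on S. norm (f x) \<le> C" and D: "AE x in lebesgue_on S. norm (u x) \<le> D"
    using assms by (auto simp: L_inf_def)
  have "AE x in lebesgue_on S. norm (f x *\<^sub>R u x) \<le> C * D"
    using C D by eventually_elim (auto intro!: mult_mono')
  with assms show ?thesis by (auto simp: L_inf_def)
qed

lemma L_inf_subset:
  fixes u :: "real \<Rightarrow> 'a::euclidean_space"
  assumes "u \<in> L_inf S" "T \<subseteq> S" "S \<in> sets lebesgue" "T \<in> sets lebesgue"
  shows "u \<in> L_inf T"
proof -
  have "u \<in> borel_measurable (lebesgue_on T)"
    using assms measurable_restrict_mono by (auto simp: L_inf_def)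
  with assms show ?thesis
    unfolding L_inf_def by (auto simp: AE_lebesgue_on_iff elim!: eventually_mono)
qed

lemma loc_integrable_L_inf:
  fixes u :: "real \<Rightarrow> 'a::euclidean_space"
  assumes "u \<in> L_inf {a<..<b}"
  shows "loc_integrable {a<..<b} u"
  unfolding loc_integrable_def
  by (auto intro: set_integrable_subset[OF L_inf_absolutely_integrable[OF assms]] lmeasurable_compact fmeasurableD)

text \<open>The meaning given to \<open>P' = w\<close> when \<open>w\<close> matters only up to null sets: it determines \<open>P\<close> at every
point of the interval from \<open>P a\<close>.\<close>

definition is_primitive :: "real \<Rightarrow> real \<Rightarrow> (real \<Rightarrow> 'a::euclidean_space) \<Rightarrow> (real \<Rightarrow> 'a) \<Rightarrow> bool" where
  "is_primitive a b w P \<longleftrightarrow> (\<forall>x\<in>{a..b}. (w has_integral (P x - P a)) {a..x})"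

lemma is_primitive_has_integral:
  assumes "is_primitive a b w P" "a \<le> x" "x \<le> y" "y \<le> b"
  shows "(w has_integral (P y - P x)) {x..y}"
proof -
  have x: "(w has_integral (P x - P a)) {a..x}" and y: "(w has_integral (P y - P a)) {a..y}"
    using assms by (auto simp: is_primitive_def)
  have "w integrable_on {x..y}"
    by (rule integrable_subinterval_real[OF has_integral_integrable[OF y]]) (use assms in auto)
  then have i: "(w has_integral integral {x..y} w) {x..y}" by (rule integrable_integral)
  have "(P x - P a) + integral {x..y} w = P y - P a"
    by (rule has_integral_unique[OF has_integral_combine[OF _ _ x i] y]) (use assms in auto)
  then have "integral {x..y} w = P y - P x" by (simp add: algebra_simps)
  with i show ?thesis by simp
qed

lemma is_primitiveI_derivative:
  assumes "\<And>x. x \<in> {a..b} \<Longrightarrow> (P has_vector_derivative w x) (at x within {a..b})"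
  shows "is_primitive a b w P"
  unfolding is_primitive_def
proof
  fix x assume "x \<in> {a..b}"
  then show "(w has_integral (P x - P a)) {a..x}"
    by (intro fundamental_theorem_of_calculus has_vector_derivative_within_subset[OF assms]) auto
qed

text \<open>Essentially bounded integrands are bounded only off a null set, where they can be replaced by zero.\<close>

lemma has_integral_bound_off_negligible:
  fixes f :: "real \<Rightarrow> 'a::euclidean_space"
  assumes f: "(f has_integral i) {x..y}" and "negligible N" "B \<ge> 0" "x \<le> y"
    and B: "\<And>t. t \<in> {x..y} - N \<Longrightarrow> norm (f t) \<le> B"
  shows "norm i \<le> B * (y - x)"
proof -
  have "((\<lambda>t. if t \<in> N then 0 else f t) has_integral i) {x..y}"
    by (rule has_integral_spike[OF \<open>negligible N\<close> _ f]) auto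
  then have "norm i \<le> B * measure lborel {x..y}"
    by (rule has_integral_bound_real[OF \<open>B \<ge> 0\<close> finite.emptyI]) (use B \<open>B \<ge> 0\<close> in auto)
  with \<open>x \<le> y\<close> show ?thesis by simp
qed

lemma is_primitive_Lipschitz:
  fixes w :: "real \<Rightarrow> 'a::euclidean_space"
  assumes "is_primitive a b w P" "w \<in> L_inf {a<..<b}"
  shows "\<exists>C N. C \<ge> 0 \<and> negligible N \<and> (\<forall>t\<in>{a..b} - N. norm (w t) \<le> C) \<and>
    (\<forall>x y. a \<le> x \<longrightarrow> x \<le> y \<longrightarrow> y \<le> b \<longrightarrow> norm (P y - P x) \<le> C * (y - x))"
proof -
  obtain N C where "negligible N" and C: "C \<ge> 0" and b: "\<And>t. t \<in> {a<..<b} - N \<Longrightarrow> norm (w t) \<le> C"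
    by (rule L_inf_bounded_off_negligible[OF assms(2)]) auto
  define M where "M = N \<union> {a, b}"
  have M: "negligible M" using \<open>negligible N\<close> by (simp add: M_def negligible_Un)
  have bM: "norm (w t) \<le> C" if "t \<in> {a..b} - M" for t using that by (intro b) (auto simp: M_def)
  show ?thesis
  proof (intro exI conjI allI impI ballI)
    fix x y assume xy: "a \<le> x" "x \<le> y" "y \<le> b"
    show "norm (P y - P x) \<le> C * (y - x)"
      by (rule has_integral_bound_off_negligible[OF is_primitive_has_integral[OF assms(1) xy] M C])
        (use xy bM in auto)
  qed (use C M bM in auto)
qed

lemma is_primitive_continuous:
  assumes "is_primitive a b w P"
  shows "continuous_on {a..b} P"
proof (cases "a \<le> b")
  case True
  then have w: "w integrable_on {a..b}" using assms by (force simp: is_primitive_def)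
  have "continuous_on {a..b} (\<lambda>x. integral {a..x} w + P a)"
    by (intro continuous_intros indefinite_integral_continuous_1 w)
  moreover have "integral {a..x} w + P a = P x" if "x \<in> {a..b}" for x
    using integral_unique[of w "P x - P a" "{a..x}"] assms that by (simp add: is_primitive_def)
  ultimately show ?thesis by (rule continuous_on_eq)
qed simp

text \<open>A quadratic bound on increments forces the derivative to be zero at every point, not only almost everywhere.\<close>

lemma quadratic_bound_imp_constant:
  fixes F :: "real \<Rightarrow> 'a::euclidean_space"
  assumes "\<And>x y. a \<le> x \<Longrightarrow> x \<le> y \<Longrightarrow> y \<le> b \<Longrightarrow> norm (F y - F x) \<le> B * (y - x)\<^sup>2"
    and "B \<ge> 0" "x \<in> {a..b}" "y \<in> {a..b}"
  shows "F x = F y"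
proof (rule has_derivative_zero_unique[OF _ _ assms(3,4)])
  fix x assume x: "x \<in> {a..b}"
  have B: "norm (F y - F x) \<le> B * (y - x)\<^sup>2" if "y \<in> {a..b}" for y
    using assms(1)[of x y] assms(1)[of y x] x that
    by (cases "x \<le> y") (auto simp: norm_minus_commute power2_commute)
  show "(F has_derivative (\<lambda>h. 0)) (at x within {a..b})"
    unfolding has_derivative_within_alt
  proof (intro conjI allI impI)
    fix e :: real assume "e > 0"
    show "\<exists>d>0. \<forall>y\<in>{a..b}. norm (y - x) < d \<longrightarrow> norm (F y - F x - 0) \<le> e * norm (y - x)"
    proof (intro exI[of _ "e / (B + 1)"] conjI ballI impI)
      fix y assume y: "y \<in> {a..b}" "norm (y - x) < e / (B + 1)"
      have "B * \<bar>y - x\<bar> \<le> (B + 1) * \<bar>y - x\<bar>" by (simp add: algebra_simps)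
      also have "\<dots> \<le> e" using y(2) \<open>B \<ge> 0\<close> by (simp add: field_simps)
      finally have "B * \<bar>y - x\<bar> * \<bar>y - x\<bar> \<le> e * \<bar>y - x\<bar>" by (intro mult_right_mono) auto
      with B[OF y(1)] show "norm (F y - F x - 0) \<le> e * norm (y - x)"
        by (simp add: power2_eq_square mult.assoc)
    qed (use \<open>e > 0\<close> \<open>B \<ge> 0\<close> in auto)
  qed simp
qed simp

text \<open>Let \<open>F\<close> be \<open>\<theta> P\<close> minus the indefinite integral of \<open>\<theta>' P + \<theta> w\<close>. Writing
\<open>\<theta>(y) P(y) - \<theta>(x) P(x) = (\<theta>(y) - \<theta>(x)) P(y) + \<theta>(x) (P(y) - P(x))\<close> and both differences as integrals,
the increment of \<open>F\<close> is the integral over \<open>[x, y]\<close> of \<open>\<theta>'(t) (P(y) - P(t)) + (\<theta>(x) - \<theta>(t)) w(t)\<close>. As \<open>\<theta>\<close> and \<open>P\<close>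
are Lipschitz, it is of order \<open>(y - x)\<^sup>2\<close>, so \<open>F\<close> is constant.\<close>

lemma primitive_integration_by_parts:
  fixes w :: "real \<Rightarrow> 'a::euclidean_space"
  assumes P: "is_primitive a b w P" and w: "w \<in> L_inf {a<..<b}" and "a \<le> b"
    and der: "\<And>x. x \<in> {a..b} \<Longrightarrow> (\<theta> has_real_derivative \<theta>' x) (at x within {a..b})"
    and cont: "continuous_on {a..b} \<theta>'"
  shows "((\<lambda>t. \<theta>' t *\<^sub>R P t + \<theta> t *\<^sub>R w t) has_integral (\<theta> b *\<^sub>R P b - \<theta> a *\<^sub>R P a)) {a..b}"
proof -
  obtain C N where C: "C \<ge> 0" "negligible N" "\<forall>t\<in>{a..b} - N. norm (w t) \<le> C"
    "\<forall>x y. a \<le> x \<longrightarrow> x \<le> y \<longrightarrow> y \<le> b \<longrightarrow> norm (P y - P x) \<le> C * (y - x)"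
    using is_primitive_Lipschitz[OF P w] by blast
  have \<theta>_prim: "is_primitive a b \<theta>' \<theta>"
    using der by (intro is_primitiveI_derivative) (simp add: has_real_derivative_iff_has_vector_derivative)
  obtain K M where K: "K \<ge> 0" "negligible M" "\<forall>t\<in>{a..b} - M. norm (\<theta>' t) \<le> K"
    "\<forall>x y. a \<le> x \<longrightarrow> x \<le> y \<longrightarrow> y \<le> b \<longrightarrow> norm (\<theta> y - \<theta> x) \<le> K * (y - x)"
    using is_primitive_Lipschitz[OF \<theta>_prim L_inf_continuous[OF cont]] by blast
  define f where "f = (\<lambda>t. \<theta>' t *\<^sub>R P t + \<theta> t *\<^sub>R w t)"
  have "(\<lambda>t. \<theta>' t *\<^sub>R P t) integrable_on {a..b}"
    by (intro integrable_continuous_real continuous_intros cont is_primitive_continuous[OF P])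
  moreover have "(\<lambda>t. \<theta> t *\<^sub>R w t) absolutely_integrable_on {a..b}"
    by (subst absolutely_integrable_on_Icc_iff_Ioo)
      (intro L_inf_absolutely_integrable L_inf_scaleR w L_inf_continuous is_primitive_continuous[OF \<theta>_prim])
  then have "(\<lambda>t. \<theta> t *\<^sub>R w t) integrable_on {a..b}" by (rule set_lebesgue_integral_eq_integral(1))
  ultimately have f: "f integrable_on {a..b}" unfolding f_def by (rule integrable_add)
  define F where "F = (\<lambda>x. \<theta> x *\<^sub>R P x - integral {a..x} f)"
  have "F a = F b"
  proof (rule quadratic_bound_imp_constant)
    fix x y assume xy: "a \<le> x" "x \<le> y" "y \<le> b"
    have "f integrable_on {x..y}"
      by (rule integrable_subinterval_real[OF f]) (use xy in auto)
    moreover have "f integrable_on {a..y}"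
      by (rule integrable_subinterval_real[OF f]) (use xy in auto)
    then have "integral {a..x} f + integral {x..y} f = integral {a..y} f"
      by (intro Henstock_Kurzweil_Integration.integral_combine) (use xy in auto)
    ultimately have fxy: "(f has_integral integral {a..y} f - integral {a..x} f) {x..y}"
      by (metis add_diff_cancel_left' integrable_integral)
    have "((\<lambda>t. \<theta>' t *\<^sub>R P y + \<theta> x *\<^sub>R w t - f t) has_integral
        (\<theta> y - \<theta> x) *\<^sub>R P y + \<theta> x *\<^sub>R (P y - P x) - (integral {a..y} f - integral {a..x} f)) {x..y}"
      by (intro has_integral_diff has_integral_add has_integral_scaleR_left has_integral_cmul fxy
          is_primitive_has_integral[OF P xy] is_primitive_has_integral[OF \<theta>_prim xy])
    moreover have "(\<theta> y - \<theta> x) *\<^sub>R P y + \<theta> x *\<^sub>R (P y - P x) - (integral {a..y} f - integral {a..x} f) = F y - F x"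
      by (simp add: F_def algebra_simps)
    moreover have "\<theta>' t *\<^sub>R P y + \<theta> x *\<^sub>R w t - f t = \<theta>' t *\<^sub>R (P y - P t) + (\<theta> x - \<theta> t) *\<^sub>R w t" for t
      by (simp add: f_def algebra_simps)
    ultimately have "((\<lambda>t. \<theta>' t *\<^sub>R (P y - P t) + (\<theta> x - \<theta> t) *\<^sub>R w t) has_integral (F y - F x)) {x..y}"
      by simp
    then have "norm (F y - F x) \<le> (2 * K * C * (y - x)) * (y - x)"
    proof (rule has_integral_bound_off_negligible)
      show "negligible (M \<union> N)" using K C by (simp add: negligible_Un)
      fix t assume t: "t \<in> {x..y} - (M \<union> N)"
      have "norm (\<theta>' t *\<^sub>R (P y - P t)) \<le> K * (C * (y - x))"
        unfolding norm_scaleR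
      proof (rule mult_mono)
        show "norm (P y - P t) \<le> C * (y - x)"
          using C(4)[rule_format, of t y] t xy C(1) mult_left_mono[of "y - t" "y - x" C] by auto
      qed (use K(1) K(3)[rule_format, of t] t xy in auto)
      moreover have "norm ((\<theta> x - \<theta> t) *\<^sub>R w t) \<le> (K * (y - x)) * C"
        unfolding norm_scaleR
      proof (rule mult_mono)
        show "\<bar>\<theta> x - \<theta> t\<bar> \<le> K * (y - x)"
          using K(4)[rule_format, of x t] t xy K(1) mult_left_mono[of "t - x" "y - x" K] by auto
      qed (use C(3)[rule_format, of t] K(1) t xy in auto)
      ultimately show "norm (\<theta>' t *\<^sub>R (P y - P t) + (\<theta> x - \<theta> t) *\<^sub>R w t) \<le> 2 * K * C * (y - x)"
        using norm_triangle_ineq[of "\<theta>' t *\<^sub>R (P y - P t)" "(\<theta> x - \<theta> t) *\<^sub>R w t"]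
        by (simp add: algebra_simps)
    qed (use K(1) C(1) xy in auto)
    then show "norm (F y - F x) \<le> (2 * K * C) * (y - x)\<^sup>2" by (simp add: power2_eq_square algebra_simps)
  qed (use K(1) C(1) \<open>a \<le> b\<close> in auto)
  then have "integral {a..b} f = \<theta> b *\<^sub>R P b - \<theta> a *\<^sub>R P a"
    by (simp add: F_def algebra_simps)
  with integrable_integral[OF f] show ?thesis by (simp add: f_def)
qed

lemma test_functionsD:
  assumes "\<theta> \<in> test_functions S"
  shows "(\<theta> has_real_derivative deriv \<theta> x) (at x within T)" "deriv \<theta> \<in> test_functions S"
    "continuous_on T (deriv \<theta>)" "x \<notin> S \<Longrightarrow> \<theta> x = 0"
proof -
  obtain K where smooth: "\<And>n x. (deriv ^^ n) \<theta> differentiable (at x)"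
    and K: "compact K" "K \<subseteq> S" "\<And>x. x \<notin> K \<Longrightarrow> \<theta> x = 0"
    using assms by (auto simp: test_functions_def)
  have der: "(\<theta> has_real_derivative deriv \<theta> x) (at x)" for x
    using smooth[of 0 x] by (auto simp: real_differentiable_def DERIV_imp_deriv)
  then show "(\<theta> has_real_derivative deriv \<theta> x) (at x within T)" by (rule DERIV_subset) auto
  have smooth': "(deriv ^^ n) (deriv \<theta>) differentiable (at x)" for n x
    using smooth[of "Suc n" x] by (simp add: funpow_Suc_right del: funpow.simps)
  have "deriv \<theta> x = 0" if "x \<notin> K" for x
  proof (rule DERIV_unique[OF der])
    show "(\<theta> has_real_derivative 0) (at x)"
      by (rule has_field_derivative_transform_within_open[of "\<lambda>_. 0" _ _ "- K"])
        (use that K compact_imp_closed in auto)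
  qed
  with smooth' K show "deriv \<theta> \<in> test_functions S" by (auto simp: test_functions_def)
  show "continuous_on T (deriv \<theta>)"
    using smooth'[of 0] by (auto intro!: continuous_at_imp_continuous_on differentiable_imp_continuous_within)
  show "x \<notin> S \<Longrightarrow> \<theta> x = 0" using K by auto
qed

lemma primitive_has_weak_deriv:
  fixes w :: "real \<Rightarrow> 'a::euclidean_space"
  assumes P: "is_primitive a b w P" and w: "w \<in> L_inf {a<..<b}" and "a \<le> b"
  shows "has_weak_deriv {a<..<b} P w"
  unfolding has_weak_deriv_def
proof (intro conjI ballI)
  have P': "P \<in> L_inf {a<..<b}" by (rule L_inf_continuous[OF is_primitive_continuous[OF P]])
  from P' w show "loc_integrable {a<..<b} P" "loc_integrable {a<..<b} w"
    by (simp_all add: loc_integrable_L_inf)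
  fix \<theta> assume \<theta>: "\<theta> \<in> test_functions {a<..<b}"
  note D = test_functionsD[OF \<theta>] test_functionsD[OF test_functionsD(2)[OF \<theta>]]
  have "continuous_on {a..b} \<theta>" using D(1) by (auto intro: DERIV_continuous_on)
  then have 1: "(\<lambda>x. \<theta> x *\<^sub>R w x) absolutely_integrable_on {a<..<b}"
    by (intro L_inf_absolutely_integrable L_inf_scaleR L_inf_continuous w)
  have 2: "(\<lambda>x. deriv \<theta> x *\<^sub>R P x) absolutely_integrable_on {a<..<b}"
    by (intro L_inf_absolutely_integrable L_inf_scaleR L_inf_continuous P' D)
  have "((\<lambda>t. deriv \<theta> t *\<^sub>R P t + \<theta> t *\<^sub>R w t) has_integral 0) {a..b}"
    using primitive_integration_by_parts[OF assms D(1) D(3)] D(4)[of a] D(4)[of b] by simp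
  then have "((\<lambda>t. deriv \<theta> t *\<^sub>R P t + \<theta> t *\<^sub>R w t) has_integral 0) {a<..<b}"
    by (simp add: has_integral_Icc_iff_Ioo)
  moreover have "((\<lambda>t. deriv \<theta> t *\<^sub>R P t + \<theta> t *\<^sub>R w t) has_integral
      (LINT x:{a<..<b}|lebesgue. deriv \<theta> x *\<^sub>R P x) + (LINT x:{a<..<b}|lebesgue. \<theta> x *\<^sub>R w x)) {a<..<b}"
    by (intro has_integral_add has_integral_set_lebesgue 1 2)
  ultimately have "(LINT x:{a<..<b}|lebesgue. deriv \<theta> x *\<^sub>R P x) + (LINT x:{a<..<b}|lebesgue. \<theta> x *\<^sub>R w x) = 0"
    by (blast dest: has_integral_unique)
  then show "(LINT x:{a<..<b}|lebesgue. deriv \<theta> x *\<^sub>R P x) = - (LINT x:{a<..<b}|lebesgue. \<theta> x *\<^sub>R w x)"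
    by (simp add: add_eq_0_iff)
qed

text \<open>The function \<open>p\<close> and the indefinite integral of \<open>w\<close> have the same weak derivative, so their difference,
being continuous, is constant by \<open>du_Bois_Reymond\<close>.\<close>

lemma continuous_weak_deriv_imp_primitive:
  fixes w :: "real \<Rightarrow> 'a::euclidean_space"
  assumes p: "continuous_on {a..b} p" and w: "w \<in> L_inf {a<..<b}" and wd: "has_weak_deriv {a<..<b} p w"
  shows "is_primitive a b w p"
proof (cases "a \<le> b")
  case True
  define P where "P = (\<lambda>x. integral {a..x} w)"
  have wi: "w integrable_on {a..b}"
    using L_inf_absolutely_integrable[OF w] set_lebesgue_integral_eq_integral(1)
    by (simp add: integrable_on_Icc_iff_Ioo)
  have P: "is_primitive a b w P"
    unfolding is_primitive_def P_def
    by (auto intro!: integrable_integral integrable_subinterval_real[OF wi])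
  note Pc = is_primitive_continuous[OF P]
  have "p x - P x = p y - P y" if "x \<in> {a..b}" "y \<in> {a..b}" for x y
  proof (rule du_Bois_Reymond[OF _ _ that])
    show "continuous_on {a..b} (\<lambda>x. p x - P x)" by (intro continuous_intros p Pc)
    fix \<theta> assume \<theta>: "\<theta> \<in> test_functions {a<..<b}"
    note D = test_functionsD[OF \<theta>]
    have "((\<lambda>t. deriv \<theta> t *\<^sub>R p t - deriv \<theta> t *\<^sub>R P t) has_integral
      (LINT x:{a<..<b}|lebesgue. deriv \<theta> x *\<^sub>R p x) - (LINT x:{a<..<b}|lebesgue. deriv \<theta> x *\<^sub>R P x)) {a<..<b}"
      by (intro has_integral_diff has_integral_set_lebesgue L_inf_absolutely_integrable L_inf_scaleR
          L_inf_continuous p Pc D)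
    moreover have "(LINT x:{a<..<b}|lebesgue. deriv \<theta> x *\<^sub>R p x) = (LINT x:{a<..<b}|lebesgue. deriv \<theta> x *\<^sub>R P x)"
      using wd primitive_has_weak_deriv[OF P w True] \<theta> by (simp add: has_weak_deriv_def)
    ultimately show "((\<lambda>t. deriv \<theta> t *\<^sub>R (p t - P t)) has_integral 0) {a..b}"
      by (simp add: scaleR_diff_right has_integral_Icc_iff_Ioo)
  qed
  note const = this
  have "p x - p a = P x - P a" if "x \<in> {a..b}" for x
    using const[OF that, of a] True by (simp add: algebra_simps)
  with P show ?thesis by (simp add: is_primitive_def)
qed (simp add: is_primitive_def)

text \<open>The integrals against \<open>v\<close> and \<open>w\<close> agree once \<open>\<theta> v\<close> is measurable, which it inherits from \<open>\<theta> w\<close> because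
Lebesgue measure is complete.\<close>

lemma has_weak_deriv_cong_AE:
  fixes v w :: "real \<Rightarrow> 'a::euclidean_space"
  assumes wd: "has_weak_deriv {a<..<b} p v" and w: "w \<in> L_inf {a<..<b}"
    and ae: "AE x in lebesgue_on {a<..<b}. v x = w x"
  shows "has_weak_deriv {a<..<b} p w"
proof -
  have "(LINT x:{a<..<b}|lebesgue. \<theta> x *\<^sub>R v x) = (LINT x:{a<..<b}|lebesgue. \<theta> x *\<^sub>R w x)"
    if \<theta>: "\<theta> \<in> test_functions {a<..<b}" for \<theta>
  proof -
    have "continuous_on {a..b} \<theta>" using test_functionsD(1)[OF \<theta>] by (auto intro: DERIV_continuous_on)
    then have "(\<lambda>x. \<theta> x *\<^sub>R w x) absolutely_integrable_on {a<..<b}"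
      by (intro L_inf_absolutely_integrable L_inf_scaleR L_inf_continuous w)
    then have m: "(\<lambda>x. indicator {a<..<b} x *\<^sub>R \<theta> x *\<^sub>R w x) \<in> borel_measurable lebesgue"
      by (auto simp: set_integrable_def)
    moreover have e: "AE x in lebesgue. indicator {a<..<b} x *\<^sub>R \<theta> x *\<^sub>R w x = indicator {a<..<b} x *\<^sub>R \<theta> x *\<^sub>R v x"
      using ae by (auto simp: AE_lebesgue_on_iff indicator_def elim!: eventually_mono)
    ultimately have "(\<lambda>x. indicator {a<..<b} x *\<^sub>R \<theta> x *\<^sub>R v x) \<in> borel_measurable lebesgue"
      by (rule borel_measurable_AE)
    from integral_cong_AE[OF m this e] show ?thesis by (simp add: set_lebesgue_integral_def)
  qed
  with wd loc_integrable_L_inf[OF w] show ?thesis by (simp add: has_weak_deriv_def)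
qed

text \<open>The derivative of a test function is again a test function, and on these \<open>p\<close> and \<open>u'\<close> have equal integrals
because both are weak derivatives of \<open>u\<close>. The definition of the weak derivative of \<open>p\<close> only tests \<open>p\<close> with such
functions.\<close>

lemma weak_second_deriv_of_derivative:
  fixes u :: "real \<Rightarrow> 'a::euclidean_space"
  assumes der: "\<And>x. x \<in> {a..b} \<Longrightarrow> (u has_vector_derivative p x) (at x within {a..b})"
    and p: "continuous_on {a..b} p" and "a \<le> b"
    and u': "has_weak_deriv {a<..<b} u u'" and u'': "has_weak_deriv {a<..<b} u' u''"
  shows "has_weak_deriv {a<..<b} p u''"
proof -
  have p': "p \<in> L_inf {a<..<b}" by (rule L_inf_continuous[OF p])
  have up: "has_weak_deriv {a<..<b} u p"
    by (intro primitive_has_weak_deriv is_primitiveI_derivative der p' \<open>a \<le> b\<close>)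
  have "(LINT x:{a<..<b}|lebesgue. deriv \<theta> x *\<^sub>R p x) = (LINT x:{a<..<b}|lebesgue. deriv \<theta> x *\<^sub>R u' x)"
    if "\<theta> \<in> test_functions {a<..<b}" for \<theta>
    using up u' test_functionsD(2)[OF that] by (simp add: has_weak_deriv_def)
  with u'' loc_integrable_L_inf[OF p'] show ?thesis by (simp add: has_weak_deriv_def)
qed

section \<open>Initial value problems with an essentially bounded coefficient\<close>

text \<open>For \<open>G\<close> the indefinite integral of \<open>m\<close>, the function \<open>exp (- L x) G x\<close> starts at zero and its derivative
\<open>exp (- L x) (m x - L G x)\<close> is nonpositive.\<close>

lemma Gronwall_zero_forward:
  fixes m :: "real \<Rightarrow> real"
  assumes m: "continuous_on {a..b} m" and "L \<ge> 0"
    and le: "\<And>x. x \<in> {a..b} \<Longrightarrow> m x \<le> L * integral {a..x} m" and x: "x \<in> {a..b}"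
  shows "m x \<le> 0"
proof -
  define G where "G = (\<lambda>x. integral {a..x} m)"
  have G: "(G has_real_derivative m t) (at t within {a..b})" if "t \<in> {a..b}" for t
    unfolding G_def by (rule integral_has_real_derivative[OF m that])
  have "((\<lambda>t. exp (- L * t) * G t) has_real_derivative exp (- L * t) * (m t - L * G t)) (at t within {a..x})"
    if "t \<in> {a..x}" for t
  proof -
    have "(G has_real_derivative m t) (at t within {a..x})"
      by (rule DERIV_subset[OF G]) (use that x in auto)
    then show ?thesis by (auto intro!: derivative_eq_intros simp: algebra_simps)
  qed
  then have "((\<lambda>t. exp (- L * t) * (m t - L * G t)) has_integral
      exp (- L * x) * G x - exp (- L * a) * G a) {a..x}"
    using x by (intro fundamental_theorem_of_calculus)
      (auto simp: has_real_derivative_iff_has_vector_derivative)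
  then have "exp (- L * x) * G x - exp (- L * a) * G a \<le> 0"
    by (rule has_integral_le[OF _ has_integral_0]) (use le x in \<open>auto simp: G_def mult_le_0_iff\<close>)
  then have "G x \<le> 0" by (simp add: G_def mult_le_0_iff)
  with le[OF x] \<open>L \<ge> 0\<close> show ?thesis by (simp add: G_def mult_nonneg_nonpos order_trans)
qed

lemma Gronwall_zero_backward:
  fixes m :: "real \<Rightarrow> real"
  assumes m: "continuous_on {a..b} m" and "L \<ge> 0"
    and le: "\<And>x. x \<in> {a..b} \<Longrightarrow> m x \<le> L * integral {x..b} m" and x: "x \<in> {a..b}"
  shows "m x \<le> 0"
proof -
  have "m (- (- x)) \<le> 0"
  proof (rule Gronwall_zero_forward[where m = "\<lambda>x. m (- x)" and a = "- b" and b = "- a" and x = "- x"])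
    show "continuous_on {- b..- a} (\<lambda>x. m (- x))"
      by (rule continuous_on_compose2[OF m]) (auto intro: continuous_intros)
    fix t assume "t \<in> {- b..- a}"
    then have "m (- t) \<le> L * integral {- t..b} m" by (intro le) auto
    also have "integral {- t..b} m = integral {- b..t} (\<lambda>x. m (- x))"
      using Henstock_Kurzweil_Integration.integral_reflect_real[of b "- t" m] by simp
    finally show "m (- t) \<le> L * integral {- b..t} (\<lambda>x. m (- x))" .
  qed (use x \<open>L \<ge> 0\<close> in auto)
  then show ?thesis by simp
qed

text \<open>The equation \<open>u'' = k u\<close> as a first order system for \<open>(u, p)\<close> in integrated form. All values, including
those at the end points, are point values of continuous functions, so solutions can be compared and
glued pointwise.\<close>

definition caratheodory_solution ::
    "(real \<Rightarrow> real) \<Rightarrow> real \<Rightarrow> real \<Rightarrow> (real \<Rightarrow> 'a::euclidean_space) \<Rightarrow> (real \<Rightarrow> 'a) \<Rightarrow> bool" where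
  "caratheodory_solution k a b u p \<longleftrightarrow>
     (\<forall>x\<in>{a..b}. (u has_vector_derivative p x) (at x within {a..b})) \<and>
     is_primitive a b (\<lambda>x. k x *\<^sub>R u x) p"

lemma caratheodory_solution_continuous:
  assumes "caratheodory_solution k a b u p"
  shows "continuous_on {a..b} u" "continuous_on {a..b} p"
proof -
  show "continuous_on {a..b} u"
    by (rule continuous_on_vector_derivative[where f' = p]) (use assms in \<open>simp add: caratheodory_solution_def\<close>)
  show "continuous_on {a..b} p"
    by (rule is_primitive_continuous[where w = "\<lambda>x. k x *\<^sub>R u x"]) (use assms in \<open>simp add: caratheodory_solution_def\<close>)
qed

lemma caratheodory_solution_diff:
  assumes "caratheodory_solution k a b u p" "caratheodory_solution k a b v q"
  shows "caratheodory_solution k a b (\<lambda>x. u x - v x) (\<lambda>x. p x - q x)"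
  unfolding caratheodory_solution_def is_primitive_def
proof (intro conjI ballI)
  fix x assume x: "x \<in> {a..b}"
  then show "((\<lambda>x. u x - v x) has_vector_derivative p x - q x) (at x within {a..b})"
    using assms by (auto simp: caratheodory_solution_def intro: has_vector_derivative_diff)
  have "((\<lambda>x. k x *\<^sub>R u x - k x *\<^sub>R v x) has_integral (p x - p a) - (q x - q a)) {a..x}"
    using assms x by (intro has_integral_diff) (auto simp: caratheodory_solution_def is_primitive_def)
  then show "((\<lambda>x. k x *\<^sub>R (u x - v x)) has_integral p x - q x - (p a - q a)) {a..x}"
    by (simp add: algebra_simps)
qed

lemma caratheodory_solution_linear:
  assumes f: "bounded_linear f" and u: "caratheodory_solution k a b u p"
  shows "caratheodory_solution k a b (\<lambda>x. f (u x)) (\<lambda>x. f (p x))"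
  unfolding caratheodory_solution_def is_primitive_def
proof (intro conjI ballI)
  fix x assume x: "x \<in> {a..b}"
  interpret bounded_linear f by fact
  from x u show "((\<lambda>x. f (u x)) has_vector_derivative f (p x)) (at x within {a..b})"
    by (auto simp: caratheodory_solution_def intro: has_vector_derivative)
  have "(f \<circ> (\<lambda>x. k x *\<^sub>R u x) has_integral f (p x - p a)) {a..x}"
    by (rule has_integral_linear[OF _ f]) (use u x in \<open>auto simp: caratheodory_solution_def is_primitive_def\<close>)
  then show "((\<lambda>x. k x *\<^sub>R f (u x)) has_integral f (p x) - f (p a)) {a..x}"
    by (simp add: o_def scaleR diff)
qed

text \<open>Matching both \<open>u\<close> and \<open>p\<close> at \<open>c\<close> suffices: the one-sided derivatives agree there, and the integrals
for \<open>p\<close> add up across \<open>c\<close>.\<close>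

lemma caratheodory_solution_glue:
  assumes u: "caratheodory_solution k a c u p" and v: "caratheodory_solution k c b v q"
    and c: "a \<le> c" "c \<le> b" and eq: "u c = v c" "p c = q c"
  shows "caratheodory_solution k a b (\<lambda>x. if x \<le> c then u x else v x) (\<lambda>x. if x \<le> c then p x else q x)"
    (is "caratheodory_solution k a b ?w ?r")
  unfolding caratheodory_solution_def is_primitive_def
proof (intro conjI ballI)
  fix x assume x: "x \<in> {a..b}"
  have un: "{a..b} = {a..c} \<union> {c..b}" using c by auto
  have "((\<lambda>x. if x \<in> {a..c} then u x else v x) has_vector_derivative
      (if x \<in> {a..c} then p x else q x)) (at x within {a..b})"
  proof (rule has_vector_derivative_If_within_closures[where T = "{c..b}"])
    have s: "{a..c} \<union> (closure {a..c} \<inter> closure {c..b}) = {a..c}"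
      "{c..b} \<union> (closure {a..c} \<inter> closure {c..b}) = {c..b}" using c by auto
    show "(u has_vector_derivative p x) (at x within {a..c} \<union> (closure {a..c} \<inter> closure {c..b}))"
      if "x \<in> {a..c} \<union> (closure {a..c} \<inter> closure {c..b})"
      using that u unfolding s by (simp add: caratheodory_solution_def)
    show "(v has_vector_derivative q x) (at x within {c..b} \<union> (closure {a..c} \<inter> closure {c..b}))"
      if "x \<in> {c..b} \<union> (closure {a..c} \<inter> closure {c..b})"
      using that v unfolding s by (simp add: caratheodory_solution_def)
    show "u x = v x" "p x = q x" if "x \<in> closure {a..c}" "x \<in> closure {c..b}"
    proof -
      from that have "x = c" by simp
      with eq show "u x = v x" "p x = q x" by auto
    qed
  qed (use x un in auto)
  then have "((\<lambda>x. if x \<in> {a..c} then u x else v x) has_vector_derivative ?r x) (at x within {a..b})"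
    using x by simp
  then show "(?w has_vector_derivative ?r x) (at x within {a..b})"
    by (rule has_vector_derivative_transform[OF x, rotated]) auto
  have left: "((\<lambda>x. k x *\<^sub>R ?w x) has_integral p y - p a) {a..y}" if "y \<in> {a..c}" for y
  proof (rule has_integral_eq)
    show "((\<lambda>x. k x *\<^sub>R u x) has_integral p y - p a) {a..y}"
      using u that by (simp add: caratheodory_solution_def is_primitive_def)
  qed (use that in auto)
  show "((\<lambda>x. k x *\<^sub>R ?w x) has_integral ?r x - ?r a) {a..x}"
  proof (cases "x \<le> c")
    case True
    with left[of x] x show ?thesis by simp
  next
    case False
    have "((\<lambda>x. k x *\<^sub>R ?w x) has_integral q x - q c) {c..x}"
    proof (rule has_integral_eq)
      show "((\<lambda>x. k x *\<^sub>R v x) has_integral q x - q c) {c..x}"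
        using v x False by (simp add: caratheodory_solution_def is_primitive_def)
    qed (use eq in auto)
    then have "((\<lambda>x. k x *\<^sub>R ?w x) has_integral (p c - p a) + (q x - q c)) {a..x}"
      by (intro has_integral_combine[of a c x] left) (use c False in auto)
    with False c eq show ?thesis by simp
  qed
qed

text \<open>The integral inequality for \<open>norm u + norm p\<close> that the two Gronwall lemmas consume, with \<open>x\<close> fixed
at the left end or \<open>y\<close> at the right end.\<close>

lemma caratheodory_solution_growth:
  fixes u :: "real \<Rightarrow> 'a::euclidean_space"
  assumes u: "caratheodory_solution k a b u p" and k: "k \<in> L_inf {a<..<b}"
  shows "\<exists>L\<ge>0. \<forall>x y. a \<le> x \<longrightarrow> x \<le> y \<longrightarrow> y \<le> b \<longrightarrow>
    norm (u y - u x) + norm (p y - p x) \<le> L * integral {x..y} (\<lambda>t. norm (u t) + norm (p t))"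
proof -
  obtain N C where N: "negligible N" and C: "C \<ge> 0" "\<And>t. t \<in> {a<..<b} - N \<Longrightarrow> norm (k t) \<le> C"
    by (rule L_inf_bounded_off_negligible[OF k]) auto
  define M where "M = N \<union> {a, b}"
  have M: "negligible M" using N by (simp add: M_def negligible_Un)
  note cont = caratheodory_solution_continuous[OF u]
  have "norm (u y - u x) + norm (p y - p x) \<le> (1 + C) * integral {x..y} (\<lambda>t. norm (u t) + norm (p t))"
    if xy: "a \<le> x" "x \<le> y" "y \<le> b" for x y
  proof -
    let ?m = "\<lambda>t. norm (u t) + norm (p t)"
    have m: "?m integrable_on {x..y}"
      by (intro integrable_continuous_real continuous_intros continuous_on_subset[OF cont(1)]
          continuous_on_subset[OF cont(2)]) (use xy in auto)
    have "(p has_integral (u y - u x)) {x..y}"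
      using u xy by (intro is_primitive_has_integral is_primitiveI_derivative)
        (auto simp: caratheodory_solution_def)
    then have 1: "norm (u y - u x) \<le> integral {x..y} ?m"
      using integral_norm_bound_integral[OF has_integral_integrable m, of p]
      by (auto simp: integral_unique)
    have "((\<lambda>t. k t *\<^sub>R u t) has_integral (p y - p x)) {x..y}"
      using u xy by (intro is_primitive_has_integral) (auto simp: caratheodory_solution_def)
    then have spike: "((\<lambda>t. if t \<in> M then 0 else k t *\<^sub>R u t) has_integral (p y - p x)) {x..y}"
      by (rule has_integral_spike[OF M, rotated]) auto
    have "norm (if t \<in> M then 0 else k t *\<^sub>R u t) \<le> C * ?m t" if "t \<in> {x..y}" for t
      using C(1) C(2)[of t] that xy by (auto simp: M_def intro!: mult_mono)
    then have "norm (p y - p x) \<le> integral {x..y} (\<lambda>t. C * ?m t)"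
      using integral_norm_bound_integral[OF has_integral_integrable[OF spike] integrable_on_mult_right[OF m]]
      unfolding integral_unique[OF spike] by blast
    then have 2: "norm (p y - p x) \<le> C * integral {x..y} ?m" by simp
    from 1 2 show ?thesis by (simp add: algebra_simps)
  qed
  with C(1) show ?thesis by (intro exI[of _ "1 + C"]) auto
qed

text \<open>Zero Cauchy data at either end point force the zero solution. Data at the left end serve to compare
solutions, data at the right end to show that the scaling factor is well-defined.\<close>

lemma caratheodory_solution_unique:
  fixes u :: "real \<Rightarrow> 'a::euclidean_space"
  assumes u: "caratheodory_solution k a b u p" and k: "k \<in> L_inf {a<..<b}"
    and c: "c = a \<or> c = b" "u c = 0" "p c = 0" and x: "x \<in> {a..b}"
  shows "u x = 0" "p x = 0"
proof -
  let ?m = "\<lambda>t. norm (u t) + norm (p t)"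
  obtain L where "L \<ge> 0" and L: "\<forall>x y. a \<le> x \<longrightarrow> x \<le> y \<longrightarrow> y \<le> b \<longrightarrow>
    norm (u y - u x) + norm (p y - p x) \<le> L * integral {x..y} ?m"
    using caratheodory_solution_growth[OF u k] by blast
  have m: "continuous_on {a..b} ?m"
    by (intro continuous_intros caratheodory_solution_continuous[OF u])
  have "?m x \<le> 0"
  proof (cases "c = a")
    case True
    show ?thesis
    proof (rule Gronwall_zero_forward[OF m \<open>L \<ge> 0\<close> _ x])
      show "?m x \<le> L * integral {a..x} ?m" if "x \<in> {a..b}" for x
        using L[rule_format, of a x] that c True by simp
    qed
  next
    case False
    show ?thesis
    proof (rule Gronwall_zero_backward[OF m \<open>L \<ge> 0\<close> _ x])
      show "?m x \<le> L * integral {x..b} ?m" if "x \<in> {a..b}" for x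
        using L[rule_format, of x b] that c False by simp
    qed
  qed
  then have "norm (u x) \<le> 0" "norm (p x) \<le> 0"
    using norm_ge_zero[of "u x"] norm_ge_zero[of "p x"] by linarith+
  then show "u x = 0" "p x = 0" by simp_all
qed

section \<open>Equivalence with the weak formulation\<close>

lemma L_inf_neg_divide:
  fixes q :: "real \<Rightarrow> real"
  shows "q \<in> L_inf {a<..<b} \<Longrightarrow> (\<lambda>x. - q x / c) \<in> L_inf {a<..<b}"
proof -
  assume q: "q \<in> L_inf {a<..<b}"
  have "(\<lambda>x. (- 1 / c) *\<^sub>R q x) \<in> L_inf {a<..<b}"
    by (intro L_inf_scaleR L_inf_continuous q continuous_on_const)
  then show "(\<lambda>x. - q x / c) \<in> L_inf {a<..<b}" by simp
qed

text \<open>The differential equation makes the second weak derivative equal almost everywhere to \<open>- (q / \<epsilon>\<^sup>2) u\<close>,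
which is essentially bounded; hence the classical derivative is the indefinite integral of the latter.\<close>

lemma weak_solution_imp_caratheodory:
  fixes u :: "real \<Rightarrow> 'a::euclidean_space"
  assumes "a < b" "\<epsilon> > 0" and q: "q \<in> L_inf {a<..<b}"
    and u: "u \<in> W2_inf a b" and ode: "solves_ode \<epsilon> q a b u"
  shows "caratheodory_solution (\<lambda>x. - q x / \<epsilon>\<^sup>2) a b u (cderiv a b u)"
proof -
  obtain p where p: "continuous_on {a..b} p"
    and der: "\<And>x. x \<in> {a..b} \<Longrightarrow> (u has_vector_derivative p x) (at x within {a..b})"
    using u by (auto simp: W2_inf_def C1_closed_def)
  have cd: "cderiv a b u x = p x" if "x \<in> {a..b}" for x
    by (rule vector_derivative_within_closed_interval[OF \<open>a < b\<close> that der[OF that]])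
  obtain u' u'' where w: "has_weak_deriv {a<..<b} u u'" "has_weak_deriv {a<..<b} u' u''"
    and eq: "AE x in lebesgue_on {a<..<b}. \<epsilon>\<^sup>2 *\<^sub>R u'' x + q x *\<^sub>R u x = 0"
    using ode by (auto simp: solves_ode_def)
  define w where "w = (\<lambda>x. (- q x / \<epsilon>\<^sup>2) *\<^sub>R u x)"
  have "continuous_on {a..b} u" using der by (rule continuous_on_vector_derivative)
  then have wL: "w \<in> L_inf {a<..<b}"
    unfolding w_def by (intro L_inf_scaleR L_inf_neg_divide q L_inf_continuous)
  have "AE x in lebesgue_on {a<..<b}. u'' x = w x"
    using eq
  proof eventually_elim
    case (elim x)
    then have "\<epsilon>\<^sup>2 *\<^sub>R u'' x = - q x *\<^sub>R u x" by (simp add: add_eq_0_iff2)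
    then have "(1 / \<epsilon>\<^sup>2) *\<^sub>R \<epsilon>\<^sup>2 *\<^sub>R u'' x = (1 / \<epsilon>\<^sup>2) *\<^sub>R (- q x *\<^sub>R u x)" by simp
    with \<open>\<epsilon> > 0\<close> show "u'' x = w x" by (simp add: w_def)
  qed
  note ae = this
  have "has_weak_deriv {a<..<b} p u''"
    by (rule weak_second_deriv_of_derivative[OF der p _ w]) (use \<open>a < b\<close> in auto)
  then have "has_weak_deriv {a<..<b} p w" using wL ae by (rule has_weak_deriv_cong_AE)
  then have "is_primitive a b w p" by (rule continuous_weak_deriv_imp_primitive[OF p wL])
  then have "is_primitive a b w (cderiv a b u)" using \<open>a < b\<close> by (simp add: is_primitive_def cd)
  with der show ?thesis by (simp add: caratheodory_solution_def w_def cd)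
qed

lemma caratheodory_solution_imp_weak:
  fixes u :: "real \<Rightarrow> 'a::euclidean_space"
  assumes "a < b" "\<epsilon> > 0" and q: "q \<in> L_inf {a<..<b}"
    and u: "caratheodory_solution (\<lambda>x. - q x / \<epsilon>\<^sup>2) a b u p"
  shows "u \<in> W2_inf a b" "solves_ode \<epsilon> q a b u" "x \<in> {a..b} \<Longrightarrow> cderiv a b u x = p x"
proof -
  define w where "w = (\<lambda>x. (- q x / \<epsilon>\<^sup>2) *\<^sub>R u x)"
  note cont = caratheodory_solution_continuous[OF u]
  have der: "\<And>x. x \<in> {a..b} \<Longrightarrow> (u has_vector_derivative p x) (at x within {a..b})"
    and pw: "is_primitive a b w p" using u by (auto simp: caratheodory_solution_def w_def)
  have uL: "u \<in> L_inf {a<..<b}" and pL: "p \<in> L_inf {a<..<b}" by (intro L_inf_continuous cont)+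
  have wL: "w \<in> L_inf {a<..<b}" unfolding w_def by (intro L_inf_scaleR L_inf_neg_divide q uL)
  have up: "has_weak_deriv {a<..<b} u p"
    using \<open>a < b\<close> by (intro primitive_has_weak_deriv is_primitiveI_derivative der pL) auto
  have pw': "has_weak_deriv {a<..<b} p w"
    using \<open>a < b\<close> by (intro primitive_has_weak_deriv pw wL) auto
  from uL pL wL up pw' have "u \<in> W_inf 2 {a<..<b}" by (auto simp: numeral_2_eq_2)
  moreover have "u \<in> C1_closed a b" using der cont by (auto simp: C1_closed_def)
  ultimately show "u \<in> W2_inf a b" by (simp add: W2_inf_def)
  have "\<epsilon>\<^sup>2 *\<^sub>R w x + q x *\<^sub>R u x = 0" for x using \<open>\<epsilon> > 0\<close> by (simp add: w_def)
  with up pw' show "solves_ode \<epsilon> q a b u" by (auto simp: solves_ode_def)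
  show "cderiv a b u x = p x" if "x \<in> {a..b}"
    by (rule vector_derivative_within_closed_interval[OF \<open>a < b\<close> that der[OF that]])
qed

section \<open>The domain decomposition algorithm\<close>

theorem proposition2:
  fixes a :: "real \<Rightarrow> real" and a0 a1 xd \<epsilon> :: real
    and chi phi :: "real \<Rightarrow> real" and psi :: "real \<Rightarrow> complex"
  assumes "0 < xd" and "xd < 1"
    and "a \<in> L_inf {0<..<1}"
    and "AE x in lebesgue_on {0<..<xd}. a x < 0"
    and "AE x in lebesgue_on {xd<..<1}. a x > 0"
    and "a0 < 0" and "a1 > 0" and "\<epsilon> > 0"
    and "step1_solution \<epsilon> a a0 xd chi"
    and "step2_solution \<epsilon> a xd chi phi"
    and "psi = step3_psi \<epsilon> a1 xd chi phi"
  shows "psi \<in> W2_inf 0 1 \<and>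
         bvp_solution \<epsilon> a a0 a1 psi \<and>
         (\<forall>u. bvp_solution \<epsilon> a a0 a1 u \<longrightarrow> (\<forall>x\<in>{0..1}. u x = psi x))"
proof -
  note xd = \<open>0 < xd\<close> \<open>xd < 1\<close>
  define k where "k = (\<lambda>x. - a x / \<epsilon>\<^sup>2)"
  have k: "k \<in> L_inf {0<..<1}" unfolding k_def by (rule L_inf_neg_divide[OF assms(3)])
  have a_left: "a \<in> L_inf {0<..<xd}" and a_right: "a \<in> L_inf {xd<..<1}"
    using xd by (auto intro!: L_inf_subset[OF assms(3)])
  have chi: "caratheodory_solution k 0 xd chi (cderiv 0 xd chi)"
    unfolding k_def by (rule weak_solution_imp_caratheodory[OF _ _ a_left])
      (use assms in \<open>auto simp: step1_solution_def\<close>)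
  have phi: "caratheodory_solution k xd 1 phi (cderiv xd 1 phi)"
    unfolding k_def by (rule weak_solution_imp_caratheodory[OF _ _ a_right])
      (use assms in \<open>auto simp: step2_solution_def\<close>)
  \<comment> \<open>The glued real solution and its derivative; \<open>psi\<close> will be a complex multiple of \<open>y\<close>.\<close>
  define y where "y = (\<lambda>x. if x \<le> xd then chi x else phi x)"
  define q where "q = (\<lambda>x. if x \<le> xd then cderiv 0 xd chi x else cderiv xd 1 phi x)"
  have y: "caratheodory_solution k 0 1 y q"
    unfolding y_def q_def
    by (rule caratheodory_solution_glue[OF chi phi]) (use assms in \<open>auto simp: step2_solution_def\<close>)
  have left: "\<epsilon> * q 0 = sqrt \<bar>a0\<bar> * y 0" and mid: "\<epsilon> * q xd = 1"
    using assms by (auto simp: y_def q_def step1_solution_def)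
  define r where "r = complex_of_real (sqrt a1)"
  have r: "r \<noteq> 0" using \<open>a1 > 0\<close> by (simp add: r_def)
  define d where "d = of_real (\<epsilon> * q 1) - \<i> * r * of_real (y 1)"
  define \<alpha> where "\<alpha> = - 2 * \<i> * r / d"
  have psi: "psi = (\<lambda>x. \<alpha> * of_real (y x))"
    using xd assms(11)
    by (auto simp: fun_eq_iff step3_psi_def step3_alpha_def \<alpha>_def d_def y_def q_def r_def)
  \<comment> \<open>If it were zero, the left boundary condition would make all Cauchy data at \<open>0\<close> vanish, against \<open>\<epsilon> y'(xd) = 1\<close>.\<close>
  have y0: "y 0 \<noteq> 0"
  proof
    assume "y 0 = 0"
    moreover from this left \<open>\<epsilon> > 0\<close> have "q 0 = 0" by simp
    ultimately have "q xd = 0" using caratheodory_solution_unique(2)[OF y k, of 0 xd] xd by simp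
    with mid show False by simp
  qed
  \<comment> \<open>Since \<open>y\<close> is real, a vanishing denominator means vanishing Cauchy data at \<open>1\<close>.\<close>
  have d: "d \<noteq> 0"
  proof
    assume "d = 0"
    then have "q 1 = 0" "y 1 = 0" using \<open>\<epsilon> > 0\<close> \<open>a1 > 0\<close> by (auto simp: d_def r_def complex_eq_iff)
    then have "y 0 = 0" using caratheodory_solution_unique(1)[OF y k, of 1 0] by simp
    with y0 show False ..
  qed
  have multiple: "caratheodory_solution k 0 1 (\<lambda>x. s * of_real (y x)) (\<lambda>x. s * of_real (q x))" for s :: complex
    by (rule caratheodory_solution_linear[OF _ y]) (intro bounded_linear_mult_right[THEN bounded_linear_compose] bounded_linear_of_real)
  note psi_weak = caratheodory_solution_imp_weak[OF _ \<open>\<epsilon> > 0\<close> assms(3) multiple[of \<alpha>, unfolded k_def], folded psi]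
  have ends: "of_real \<epsilon> * (s * of_real (q 1)) - \<i> * r * (s * of_real (y 1)) = s * d"
    "of_real \<epsilon> * (s * of_real (q 0)) - of_real (sqrt \<bar>a0\<bar>) * (s * of_real (y 0)) = 0" for s :: complex
  proof -
    show "of_real \<epsilon> * (s * of_real (q 1)) - \<i> * r * (s * of_real (y 1)) = s * d"
      by (simp add: d_def algebra_simps)
    have "of_real \<epsilon> * (s * of_real (q 0)) - of_real (sqrt \<bar>a0\<bar>) * (s * of_real (y 0))
        = s * (of_real (\<epsilon> * q 0) - of_real (sqrt \<bar>a0\<bar> * y 0))"
      by (simp add: algebra_simps)
    also have "\<dots> = 0" unfolding left by simp
    finally show "of_real \<epsilon> * (s * of_real (q 0)) - of_real (sqrt \<bar>a0\<bar>) * (s * of_real (y 0)) = 0" .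
  qed
  have bvp: "bvp_solution \<epsilon> a a0 a1 psi"
    using psi_weak ends[of \<alpha>] d by (simp add: bvp_solution_def psi r_def[symmetric] \<alpha>_def)
  have unique: "u x = psi x" if u: "bvp_solution \<epsilon> a a0 a1 u" and x: "x \<in> {0..1}" for u x
  proof -
    let ?p = "cderiv 0 1 u"
    have uc: "caratheodory_solution k 0 1 u ?p"
      unfolding k_def by (rule weak_solution_imp_caratheodory[OF _ \<open>\<epsilon> > 0\<close> assms(3)])
        (use u in \<open>auto simp: bvp_solution_def\<close>)
    \<comment> \<open>The multiple of \<open>y\<close> that agrees with \<open>u\<close> at \<open>0\<close>; the left boundary condition makes the derivatives agree too.\<close>
    define s where "s = u 0 / of_real (y 0)"
    have s0: "u 0 = s * of_real (y 0)" using y0 by (simp add: s_def)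
    have "of_real \<epsilon> * ?p 0 = of_real (sqrt \<bar>a0\<bar>) * (s * of_real (y 0))"
      using u unfolding bvp_solution_def s0 right_minus_eq by blast
    also have "\<dots> = of_real \<epsilon> * (s * of_real (q 0))"
      using ends(2)[of s] by (simp only: right_minus_eq)
    finally have p0: "?p 0 = s * of_real (q 0)" using \<open>\<epsilon> > 0\<close> by simp
    note diff = caratheodory_solution_diff[OF uc multiple[of s]]
    have us: "u t = s * of_real (y t)" and ps: "?p t = s * of_real (q t)" if "t \<in> {0..1}" for t
      using caratheodory_solution_unique[OF diff k _ _ _ that, of 0] s0 p0 by simp_all
    \<comment> \<open>The right boundary condition determines the multiple.\<close>
    have "s * d = - 2 * \<i> * r"
      using u ends(1)[of s] us[of 1] ps[of 1] by (simp add: bvp_solution_def r_def)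
    then have "s = \<alpha>" using d by (simp add: \<alpha>_def field_simps)
    with us[OF x] show ?thesis by (simp add: psi)
  qed
  from bvp have "psi \<in> W2_inf 0 1" by (simp add: bvp_solution_def)
  with bvp unique show ?thesis by blast
qed

end
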